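(* If $T$ is a (finite) tree of order $n$, then $$L_{2,t}(T)-L_2(T)\le\left\lfloor\frac n3\right\rfloor.$$ Moreover, this bound is sharp, i.e. there exist trees for which equality holds.
   Context: For a vertex $v$ of a finite simple graph $G$, $N(v)$ is its open neighborhood and $N[v]=N(v)\cup\{v\}$ its closed neighborhood. A set $B\subseteq V(G)$ is a $2$-limited packing if $|B\cap N[v]|\le2$ for every $v\in V(G)$, and a $2$-total limited packing if $|B\cap N(v)|\le 2$ for every $v\in V(G)$. $L_2(G)$ and $L_{2,t}(G)$ denote the maximum cardinality of a $2$-limited packing and of a $2$-total limited packing in $G$, respectively. *)

theory Defs
  imports Complex_Main "Graph_Theory.Digraph_Component"
begin

text \<open>
  Finite simple graphs are the \<^locale>\<open>pair_graph\<close>s of the Graph-Theory library: finite, symmetric, loop-free,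
  with arcs given as pairs, so that an edge is the pair of opposite arcs \<open>(u, v)\<close>, \<open>(v, u)\<close>.
  The library's \<^const>\<open>tree\<close> is not usable for them: its notion of cycle admits the closed walk
  \<open>u, v, u\<close>, so no symmetric digraph with an arc is a \<^const>\<open>tree\<close>.  A cycle of an undirected graph
  is one of length at least 3.  As \<^const>\<open>connected\<close> demands a nonempty vertex set, trees are nonempty.
\<close>

definition is_tree :: "'a pair_pre_digraph \<Rightarrow> bool" where
  "is_tree G \<longleftrightarrow> pair_graph G \<and> connected (with_proj G) \<and>
     \<not> (\<exists>p. pre_digraph.cycle (with_proj G) p \<and> 3 \<le> length p)"

definition open_nbhd :: "'a pair_pre_digraph \<Rightarrow> 'a \<Rightarrow> 'a set" where
  "open_nbhd G v = {u \<in> pverts G. (v, u) \<in> parcs G}"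

definition closed_nbhd :: "'a pair_pre_digraph \<Rightarrow> 'a \<Rightarrow> 'a set" where
  "closed_nbhd G v = open_nbhd G v \<union> {v}"

definition two_limited_packing :: "'a pair_pre_digraph \<Rightarrow> 'a set \<Rightarrow> bool" where
  "two_limited_packing G B \<longleftrightarrow>
     B \<subseteq> pverts G \<and> (\<forall>v \<in> pverts G. card (B \<inter> closed_nbhd G v) \<le> 2)"

definition two_total_limited_packing :: "'a pair_pre_digraph \<Rightarrow> 'a set \<Rightarrow> bool" where
  "two_total_limited_packing G B \<longleftrightarrow>
     B \<subseteq> pverts G \<and> (\<forall>v \<in> pverts G. card (B \<inter> open_nbhd G v) \<le> 2)"

text \<open>
  The maxima are over finite sets of naturals, nonempty because of \<open>B = {}\<close>, whenever
  \<open>G\<close> has finitely many vertices.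
\<close>

definition L2 :: "'a pair_pre_digraph \<Rightarrow> nat" where
  "L2 G = Max (card ` {B. two_limited_packing G B})"

definition L2t :: "'a pair_pre_digraph \<Rightarrow> nat" where
  "L2t G = Max (card ` {B. two_total_limited_packing G B})"

end

theory Submission
  imports Defs
begin

text \<open>
  Let \<open>B\<close> be a maximum 2-total limited packing of a tree \<open>T\<close>.  Every vertex has at most two
  neighbours in \<open>B\<close>, so the only obstruction to \<open>B\<close> being a 2-limited packing comes from vertices
  \<open>v \<in> B\<close> with exactly two neighbours in \<open>B\<close>; these are the inner vertices of the components of
  \<open>T[B]\<close>, which are paths.  Along each of these paths one may delete every third vertex.  Instead
  of describing the components, the proof colours \<open>B\<close> with three colours so that no colour is
  repeated inside \<open>B \<inter> N[v]\<close> for \<open>v \<in> B\<close> (\<open>rainbow_three_colouring\<close>).  The colouring is built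
  greedily along a leaf elimination order: a new leaf must avoid the colours of its neighbour and of
  the at most one other neighbour of that neighbour.  Leaves exist because a finite
  nonempty set of vertices all having two neighbours inside the set contains a cycle
  (\<open>forest_has_leaf\<close>).  The least used colour has at most \<open>card B div 3\<close> vertices, and deleting it
  leaves a 2-limited packing (\<open>limited_packing_from_total\<close>).

  Equality holds for the paths on \<open>3 * k\<close> vertices.  There the whole vertex set is 2-total limited
  since all degrees are at most two, while the vertex set is a union of \<open>k\<close> closed
  neighbourhoods, each containing at most two vertices of a 2-limited packing.
\<close>

section \<open>Leaves in graphs without cycles\<close>

lemma pawalk_along_vertex_list:
  assumes "vs \<noteq> []"
  shows "pawalk_verts (hd vs) (zip vs (tl vs)) = vs"
    and "pcas (hd vs) (zip vs (tl vs)) (last vs)"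
  using assms by (induction vs rule: induct_list012) auto

lemma successively_arcs:
  assumes "successively (\<lambda>x y. (x, y) \<in> A) vs"
  shows "set (zip vs (tl vs)) \<subseteq> A"
  using assms by (induction vs rule: induct_list012) auto

lemma cycle_from_vertex_list:
  assumes "pair_graph G" and "distinct vs" and "3 \<le> length vs"
    and adj: "successively (\<lambda>x y. (x, y) \<in> parcs G) vs" and close: "(last vs, hd vs) \<in> parcs G"
  shows "\<exists>p. pre_digraph.cycle (with_proj G) p \<and> 3 \<le> length p"
proof -
  interpret pair_graph G by fact
  have ne: "vs \<noteq> []" using assms(3) by auto
  let ?cs = "last vs # vs"
  let ?p = "zip ?cs vs"
  have "successively (\<lambda>x y. (x, y) \<in> parcs G) ?cs"
    using adj close by (simp add: successively_Cons)
  then have "set ?p \<subseteq> parcs G"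
    using successively_arcs[of "parcs G" ?cs] by simp
  moreover have "last vs \<in> pverts G"
    using close by (rule in_arcsD1)
  moreover have "pcas (last vs) ?p (last vs)"
    using pawalk_along_vertex_list(2)[of ?cs] ne by simp
  moreover have "pawalk_verts (last vs) ?p = ?cs"
    using pawalk_along_vertex_list(1)[of ?cs] by simp
  moreover have "length ?p = length vs" by simp
  ultimately have "cycle ?p \<and> 3 \<le> length ?p"
    using assms(2,3) ne unfolding cycle_def awalk_def
    by (intro conjI exI[of _ "last vs"]) auto
  then show ?thesis by blast
qed

text \<open>
  Take a longest path inside \<open>S\<close>.  All neighbours in \<open>S\<close> of its first vertex lie on the path, so a
  neighbour other than the second vertex would close a cycle of length at least three.
\<close>
lemma forest_has_leaf:
  assumes "pair_graph G" and acyclic: "\<not> (\<exists>p. pre_digraph.cycle (with_proj G) p \<and> 3 \<le> length p)"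
    and "finite S" "S \<noteq> {}"
  shows "\<exists>v\<in>S. card (S \<inter> open_nbhd G v) \<le> 1"
proof (rule ccontr)
  interpret pair_graph G by fact
  assume "\<not> ?thesis"
  then have deg: "2 \<le> card (S \<inter> open_nbhd G v)" if "v \<in> S" for v
    using that by force
  define path where "path vs \<longleftrightarrow> distinct vs \<and> vs \<noteq> [] \<and> set vs \<subseteq> S \<and>
      successively (\<lambda>x y. (x, y) \<in> parcs G) vs" for vs
  obtain s where "s \<in> S" using assms by auto
  then have "path [s]" by (simp add: path_def)
  moreover have "\<forall>vs. path vs \<longrightarrow> length vs \<le> card S"
    using \<open>finite S\<close> by (metis path_def distinct_card card_mono)
  ultimately obtain vs where vs: "path vs" and max: "\<And>ws. path ws \<Longrightarrow> length ws \<le> length vs"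
    using ex_has_greatest_nat[of path "[s]" length "Suc (card S)"] by (auto simp: less_Suc_eq_le)
  obtain v us where vs_eq: "vs = v # us"
    using vs by (cases vs) (auto simp: path_def)
  have on_path: "w \<in> set us" if "w \<in> S \<inter> open_nbhd G v" for w
  proof (rule ccontr)
    assume "w \<notin> set us"
    have "(v, w) \<in> parcs G" using that by (simp add: open_nbhd_def)
    then have "(w, v) \<in> parcs G" "w \<noteq> v"
      using arcs_symmetric no_loops' by auto
    then have "path (w # vs)"
      using vs that \<open>w \<notin> set us\<close> by (auto simp: path_def vs_eq)
    then show False using max by fastforce
  qed
  have "v \<in> S" using vs by (simp add: path_def vs_eq)
  from deg[OF this] have two: "2 \<le> card (S \<inter> open_nbhd G v)" .
  then have "S \<inter> open_nbhd G v \<noteq> {}" by auto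
  then obtain a rest where us_eq: "us = a # rest"
    using on_path by (cases us) auto
  have "\<not> S \<inter> open_nbhd G v \<subseteq> {a}"
    using two card_mono[of "{a}" "S \<inter> open_nbhd G v"] by auto
  then obtain w where w: "w \<in> S \<inter> open_nbhd G v" "w \<noteq> a" by auto
  then have "w \<in> set rest" using on_path us_eq by auto
  then obtain b c where rest_eq: "rest = b @ w # c"
    by (meson split_list)
  let ?cyc = "v # a # b @ [w]"
  have "(w, v) \<in> parcs G"
    using w arcs_symmetric by (auto simp: open_nbhd_def)
  moreover have "vs = ?cyc @ c" by (simp add: vs_eq us_eq rest_eq)
  then have "distinct ?cyc" "successively (\<lambda>x y. (x, y) \<in> parcs G) ?cyc"
    using vs unfolding path_def by (auto simp only: distinct_append successively_append_iff)
  ultimately show False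
    using acyclic cycle_from_vertex_list[OF \<open>pair_graph G\<close>, of ?cyc] by auto
qed

section \<open>From total limited packings to limited packings\<close>

text \<open>
  Remove a leaf \<open>l\<close> of \<open>G[S]\<close> and colour the rest.  Only the closed neighbourhoods of \<open>l\<close> and of its
  neighbour \<open>u\<close> in \<open>S\<close> contain \<open>l\<close>, and by the degree bound \<open>u\<close> has at most one further neighbour
  in \<open>S\<close>.  So at most two colours are forbidden for \<open>l\<close>.
\<close>
lemma rainbow_three_colouring:
  assumes "pair_graph G" and acyclic: "\<not> (\<exists>p. pre_digraph.cycle (with_proj G) p \<and> 3 \<le> length p)"
    and "finite S"
    and deg: "\<And>v. v \<in> S \<Longrightarrow> card (S \<inter> open_nbhd G v) \<le> 2"
  shows "\<exists>c :: 'a \<Rightarrow> nat. (\<forall>x. c x < 3) \<and> (\<forall>v\<in>S. inj_on c (S \<inter> closed_nbhd G v))"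
  using assms(3,4)
proof (induction S rule: finite_psubset_induct)
  case (psubset S)
  interpret pair_graph G by fact
  have sym: "x \<in> open_nbhd G y \<longleftrightarrow> y \<in> open_nbhd G x" for x y
    using arcs_symmetric in_arcsD1 by (auto simp: open_nbhd_def)
  have irrefl: "x \<notin> open_nbhd G x" for x
    using no_loops' by (auto simp: open_nbhd_def)
  show ?case
  proof (cases "S = {}")
    case True
    then show ?thesis by (intro exI[of _ "\<lambda>_. 0"]) auto
  next
    case False
    from forest_has_leaf[OF assms(1) acyclic psubset.hyps(1) False]
    obtain l where l: "l \<in> S" "card (S \<inter> open_nbhd G l) \<le> 1" by auto
    have "S - {l} \<subset> S" using l by auto
    moreover have "card ((S - {l}) \<inter> open_nbhd G v) \<le> 2" if "v \<in> S - {l}" for v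
    proof -
      have "card ((S - {l}) \<inter> open_nbhd G v) \<le> card (S \<inter> open_nbhd G v)"
        using psubset.hyps(1) by (intro card_mono) auto
      then show ?thesis using psubset.prems[of v] that by auto
    qed
    ultimately obtain c :: "'a \<Rightarrow> nat" where c: "\<And>x. c x < 3"
      and inj: "\<And>v. v \<in> S - {l} \<Longrightarrow> inj_on c ((S - {l}) \<inter> closed_nbhd G v)"
      using psubset.IH[of "S - {l}"] by blast
    \<comment> \<open>the vertices one or two steps from \<open>l\<close> inside \<open>S\<close>, whose colours \<open>l\<close> has to avoid\<close>
    define F where "F = (\<Union>u \<in> S \<inter> open_nbhd G l. (S - {l}) \<inter> closed_nbhd G u)"
    have "card F \<le> 2"
    proof (cases "S \<inter> open_nbhd G l = {}")
      case True
      then show ?thesis by (simp add: F_def)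
    next
      case False
      then obtain u where u: "S \<inter> open_nbhd G l = {u}"
        using l(2) psubset.hyps(1) by (metis card_1_singletonE card_0_eq finite_Int le_antisym
            less_one linorder_not_less)
      then have "u \<in> S" by auto
      have lu: "l \<in> S \<inter> open_nbhd G u" using u sym l by auto
      have "card (S \<inter> open_nbhd G u - {l}) \<le> 1"
        using psubset.prems[OF \<open>u \<in> S\<close>] lu psubset.hyps(1) by (auto simp: card_Diff_singleton)
      moreover have "F = insert u (S \<inter> open_nbhd G u - {l})"
        using u irrefl by (auto simp: F_def closed_nbhd_def)
      ultimately show ?thesis
        by (metis Suc_1 card_insert_le_m1 diff_Suc_1 zero_less_Suc)
    qed
    moreover have "finite F" unfolding F_def using psubset.hyps(1) by auto
    ultimately have "card (c ` F) < card {..<3::nat}"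
      using card_image_le[of F c] by simp
    then have "\<not> {..<3} \<subseteq> c ` F"
      using \<open>finite F\<close> card_mono[of "c ` F" "{..<3}"] by auto
    then obtain k where k: "k < 3" "k \<notin> c ` F" by auto
    have new: "inj_on (c(l := k)) (S \<inter> closed_nbhd G v)" if "v \<in> S" for v
    proof (cases "v = l")
      case True
      \<comment> \<open>here \<open>S \<inter> N[l]\<close> consists of \<open>l\<close> and at most one further vertex, which lies in \<open>F\<close>\<close>
      have "x = y" if "x \<in> S \<inter> open_nbhd G l" "y \<in> S \<inter> open_nbhd G l" for x y
        using that l(2) psubset.hyps(1) card_le_Suc0_iff_eq[of "S \<inter> open_nbhd G l"] by auto
      then have "inj_on (c(l := k)) (S \<inter> open_nbhd G l)" by (meson inj_onI)
      moreover have "S \<inter> open_nbhd G l \<subseteq> F"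
        using irrefl by (auto simp: F_def closed_nbhd_def)
      then have "k \<notin> c ` (S \<inter> open_nbhd G l)" using k by auto
      moreover have "S \<inter> closed_nbhd G l = insert l (S \<inter> open_nbhd G l)"
        using l by (auto simp: closed_nbhd_def)
      ultimately show ?thesis
        using True by (auto simp: inj_on_insert)
    next
      case False
      show ?thesis
      proof (cases "l \<in> open_nbhd G v")
        case True
        then have "v \<in> S \<inter> open_nbhd G l" using sym \<open>v \<in> S\<close> by auto
        then have "(S - {l}) \<inter> closed_nbhd G v \<subseteq> F" by (auto simp: F_def)
        then have "k \<notin> c ` ((S - {l}) \<inter> closed_nbhd G v)" using k by auto
        moreover have "S \<inter> closed_nbhd G v = insert l ((S - {l}) \<inter> closed_nbhd G v)"
          using True l by (auto simp: closed_nbhd_def)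
        moreover have "inj_on (c(l := k)) ((S - {l}) \<inter> closed_nbhd G v)"
          using inj[of v] False that by (auto simp: inj_on_def)
        ultimately show ?thesis
          by (auto simp: inj_on_insert)
      next
        case outside: False
        then have "S \<inter> closed_nbhd G v = (S - {l}) \<inter> closed_nbhd G v"
          using False by (auto simp: closed_nbhd_def)
        then show ?thesis using inj[of v] False that by (auto simp: inj_on_def)
      qed
    qed
    have "\<forall>x. (c(l := k)) x < 3" using c k by simp
    with new show ?thesis by blast
  qed
qed

text \<open>
  In the colouring of \<open>B\<close>, every closed neighbourhood of a vertex of \<open>B\<close> that meets \<open>B\<close> in three vertices uses all three
  colours, hence loses a vertex whichever colour is deleted; by averaging, some colour is used at
  most \<open>card B div 3\<close> times.
\<close>
lemma limited_packing_from_total: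
  assumes "is_tree G" and "two_total_limited_packing G B"
  shows "\<exists>A. two_limited_packing G A \<and> 2 * card B \<le> 3 * card A"
proof -
  have G: "pair_graph G" using assms(1) by (simp add: is_tree_def)
  interpret pair_graph G by fact
  have B: "B \<subseteq> pverts G" "\<And>v. v \<in> pverts G \<Longrightarrow> card (B \<inter> open_nbhd G v) \<le> 2"
    using assms(2) by (auto simp: two_total_limited_packing_def)
  have fin: "finite B" using B pair_finite_verts finite_subset by blast
  obtain c :: "'a \<Rightarrow> nat" where c: "\<And>x. c x < 3"
    and inj: "\<And>v. v \<in> B \<Longrightarrow> inj_on c (B \<inter> closed_nbhd G v)"
    using rainbow_three_colouring[OF G _ fin] assms(1) B unfolding is_tree_def by (metis subsetD)
  have "c ` B \<subseteq> {..<3}" using c by auto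
  then have "card B = (\<Sum>i<3. card {x \<in> B. c x = i})"
    using sum.group[OF fin, of "{..<3}" c "\<lambda>_. 1::nat"] by simp
  then have total: "(\<Sum>i<3. 3 * card {x \<in> B. c x = i}) = (\<Sum>i<3::nat. card B)"
    by (simp flip: sum_distrib_left)
  have "\<exists>i<3. 3 * card {x \<in> B. c x = i} \<le> card B"
  proof (rule ccontr)
    assume "\<not> ?thesis"
    then have "(\<Sum>i<3::nat. card B) < (\<Sum>i<3. 3 * card {x \<in> B. c x = i})"
      by (intro sum_strict_mono) (auto simp: not_le lessThan_empty_iff)
    with total show False by linarith
  qed
  then obtain i where i: "i < 3" "3 * card {x \<in> B. c x = i} \<le> card B" by blast
  let ?A = "{x \<in> B. c x \<noteq> i}"
  have "card B = card ?A + card {x \<in> B. c x = i}"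
    using fin by (subst card_Un_disjoint[symmetric]) (auto intro: arg_cong[where f = card])
  moreover have "two_limited_packing G ?A"
    unfolding two_limited_packing_def
  proof (intro conjI ballI)
    fix v assume v: "v \<in> pverts G"
    show "card (?A \<inter> closed_nbhd G v) \<le> 2"
    proof (cases "v \<in> B")
      case True
      have "inj_on c (?A \<inter> closed_nbhd G v)"
        by (rule inj_on_subset[OF inj[OF True]]) auto
      moreover have "c ` (?A \<inter> closed_nbhd G v) \<subseteq> {..<3} - {i}" using c by auto
      ultimately have "card (?A \<inter> closed_nbhd G v) \<le> card ({..<3} - {i})"
        by (intro card_inj_on_le) auto
      then show ?thesis using i by simp
    next
      case False
      then have "card (?A \<inter> closed_nbhd G v) \<le> card (B \<inter> open_nbhd G v)"
        using fin by (intro card_mono) (auto simp: closed_nbhd_def)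
      then show ?thesis using B(2)[OF v] by simp
    qed
  qed (use B in auto)
  ultimately show ?thesis using i by (intro exI[of _ ?A]) auto
qed

lemma finite_packings:
  assumes "finite (pverts G)"
  shows "finite {B. two_limited_packing G B}" "finite {B. two_total_limited_packing G B}"
  using assms by (auto intro!: finite_subset[of _ "Pow (pverts G)"]
      simp: two_limited_packing_def two_total_limited_packing_def)

lemma card_le_L2:
  "finite (pverts G) \<Longrightarrow> two_limited_packing G B \<Longrightarrow> card B \<le> L2 G"
  unfolding L2_def using finite_packings by (intro Max_ge) auto

lemma card_le_L2t:
  "finite (pverts G) \<Longrightarrow> two_total_limited_packing G B \<Longrightarrow> card B \<le> L2t G"
  unfolding L2t_def using finite_packings by (intro Max_ge) auto

lemma L2_attained:
  assumes "finite (pverts G)"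
  obtains B where "two_limited_packing G B" "L2 G = card B"
proof -
  have "two_limited_packing G {}" by (simp add: two_limited_packing_def)
  then have "L2 G \<in> card ` {B. two_limited_packing G B}"
    unfolding L2_def using finite_packings[OF assms] by (intro Max_in) auto
  then show thesis using that by auto
qed

lemma L2t_attained:
  assumes "finite (pverts G)"
  obtains B where "two_total_limited_packing G B" "L2t G = card B"
proof -
  have "two_total_limited_packing G {}" by (simp add: two_total_limited_packing_def)
  then have "L2t G \<in> card ` {B. two_total_limited_packing G B}"
    unfolding L2t_def using finite_packings[OF assms] by (intro Max_in) auto
  then show thesis using that by auto
qed

lemma tree_packing_gap:
  assumes "is_tree G"
  shows "3 * L2t G \<le> 3 * L2 G + card (pverts G)"
proof -
  interpret pair_graph G using assms by (simp add: is_tree_def)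
  obtain B where B: "two_total_limited_packing G B" "L2t G = card B"
    using L2t_attained[OF pair_finite_verts] .
  obtain A where A: "two_limited_packing G A" "2 * card B \<le> 3 * card A"
    using limited_packing_from_total[OF assms B(1)] by blast
  have "card A \<le> L2 G" using card_le_L2[OF pair_finite_verts A(1)] .
  moreover have "card B \<le> card (pverts G)"
    using B(1) pair_finite_verts by (auto simp: two_total_limited_packing_def intro: card_mono)
  ultimately show ?thesis using A B by linarith
qed

section \<open>Paths attain the bound\<close>

definition path_graph :: "nat \<Rightarrow> nat pair_pre_digraph" where
  "path_graph n = \<lparr>pverts = {..<n}, parcs = {(i, j). i < n \<and> j < n \<and> (j = Suc i \<or> i = Suc j)}\<rparr>"

lemma path_graph_simps [simp]:
  "pverts (path_graph n) = {..<n}"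
  "(i, j) \<in> parcs (path_graph n) \<longleftrightarrow> i < n \<and> j < n \<and> (j = Suc i \<or> i = Suc j)"
  by (auto simp: path_graph_def)

lemma pair_graph_path_graph: "pair_graph (path_graph n)"
proof
  show "finite (parcs (path_graph n))"
    by (rule finite_subset[of _ "{..<n} \<times> {..<n}"]) (auto simp: path_graph_def)
  show "symmetric (path_graph n)"
    by (auto simp: symmetric_def intro!: symI)
qed (auto simp: path_graph_def)

lemma connected_path_graph:
  assumes "0 < n"
  shows "connected (with_proj (path_graph n))"
proof -
  interpret pair_graph "path_graph n" by (rule pair_graph_path_graph)
  have from_0: "0 \<rightarrow>\<^sup>*\<^bsub>with_proj (path_graph n)\<^esub> i" if "i < n" for i
    using that
  proof (induction i)
    case (Suc i)
    then have "(i, Suc i) \<in> arcs_ends (with_proj (path_graph n))" by simp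
    with Suc show ?case using reachable_adj_trans[of 0 i "Suc i"] by simp
  qed (use assms in auto)
  then have "i \<rightarrow>\<^sup>*\<^bsub>with_proj (path_graph n)\<^esub> j" if "i < n" "j < n" for i j
    using that symmetric_reachable' reachable_trans by meson
  then show ?thesis
    using assms reachable_mk_symmetricI
    by (auto simp: connected_def strongly_connected_def mk_symmetric_def)
qed

text \<open>A walk in a path graph that never turns back keeps moving in the direction of its first step.\<close>
lemma path_graph_walk_monotone:
  assumes "pcas y es z" and "set es \<subseteq> parcs (path_graph n)" and "distinct (x # pawalk_verts y es)"
    and "\<bar>s\<bar> = 1" and "int y = int x + s"
  shows "int z = int y + s * int (length es)"
  using assms
proof (induction es arbitrary: x y)
  case (Cons e es)
  obtain w where e: "e = (y, w)" using Cons.prems(1) by (cases e) auto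
  have "w \<in> set (pawalk_verts w es)" by (cases es) (use Cons.prems(1) e in auto)
  then have "w \<noteq> x" using Cons.prems(3) e by auto
  moreover have "w = Suc y \<or> y = Suc w" using Cons.prems(2) e by auto
  ultimately have step: "int w = int y + s" using Cons.prems(4,5) by auto
  have "int z = int w + s * int (length es)"
    using Cons.prems e step by (intro Cons.IH[of w y]) auto
  then show ?case using step by (simp add: algebra_simps)
qed simp

text \<open>
  From its second vertex on, a cycle of length at least three is a walk that does not turn back, so
  it moves ever further from its starting point and cannot close up.
\<close>
lemma path_graph_no_cycle:
  "\<not> (\<exists>p. pre_digraph.cycle (with_proj (path_graph n)) p \<and> 3 \<le> length p)"
proof
  interpret pair_graph "path_graph n" by (rule pair_graph_path_graph)
  assume "\<exists>p. cycle p \<and> 3 \<le> length p"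
  then obtain p u where u: "awalk u p u" "distinct (tl (pawalk_verts u p))" "3 \<le> length p"
    unfolding cycle_def by auto
  from u(3) obtain e f es where p: "p = e # f # es" "es \<noteq> []"
    by (cases p; cases "tl p"; cases "tl (tl p)") auto
  obtain y w where e: "e = (u, y)" and f: "f = (y, w)"
    using u(1) p by (cases e; cases f) (auto simp: awalk_def)
  have walk: "pcas w es u" and arcs: "set es \<subseteq> parcs (path_graph n)"
    and uy: "(u, y) \<in> parcs (path_graph n)" and yw: "(y, w) \<in> parcs (path_graph n)"
    using u(1) p e f by (auto simp: awalk_def)
  have dist: "distinct (y # pawalk_verts w es)" using u(2) p e f by simp
  \<comment> \<open>the second step cannot return to \<open>u\<close>, as the cycle revisits \<open>u\<close> only at its very end\<close>
  have "w \<noteq> u"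
  proof
    assume "w = u"
    obtain g gs where es: "es = g # gs" using p(2) by (cases es) auto
    have "u \<in> set (pawalk_verts (snd g) gs)"
      using walk es awlast_if_cas[of "snd g" gs u]
      by (metis awalk_verts_non_Nil last_in_set pcas.simps(2))
    then show False using dist es walk \<open>w = u\<close> by auto
  qed
  define s where "s = int y - int u"
  have s: "\<bar>s\<bar> = 1" using uy by (auto simp: s_def)
  have step: "int w = int y + s" using yw uy \<open>w \<noteq> u\<close> by (auto simp: s_def)
  have "int u = int w + s * int (length es)"
    using path_graph_walk_monotone[OF walk arcs dist s step] .
  then have "s * (2 + int (length es)) = 0"
    using step by (simp add: s_def algebra_simps)
  then show False using s by auto
qed

lemma is_tree_path_graph: "0 < n \<Longrightarrow> is_tree (path_graph n)"
  by (simp add: is_tree_def pair_graph_path_graph connected_path_graph path_graph_no_cycle)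

lemma L2t_path_graph_ge: "n \<le> L2t (path_graph n)"
proof -
  have "card ({..<n} \<inter> open_nbhd (path_graph n) v) \<le> 2" for v
  proof -
    have "card ({..<n} \<inter> open_nbhd (path_graph n) v) \<le> card {v - 1, Suc v}"
      by (intro card_mono) (auto simp: open_nbhd_def)
    then show ?thesis by (simp add: card_insert_if split: if_splits)
  qed
  then have "two_total_limited_packing (path_graph n) {..<n}"
    by (simp add: two_total_limited_packing_def)
  from card_le_L2t[OF _ this] show ?thesis by simp
qed

text \<open>The closed neighbourhoods of the vertices \<open>3 * j + 1\<close> with \<open>j < k\<close> cover all vertices.\<close>
lemma L2_path_graph_le: "L2 (path_graph (3 * k)) \<le> 2 * k"
proof -
  let ?G = "path_graph (3 * k)"
  obtain B where B: "two_limited_packing ?G B" "L2 ?G = card B"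
    using L2_attained[of ?G] by auto
  have "B \<subseteq> (\<Union>j<k. B \<inter> closed_nbhd ?G (3 * j + 1))"
  proof
    fix x assume "x \<in> B"
    then have "x < 3 * k" using B(1) by (auto simp: two_limited_packing_def)
    then have "x div 3 < k" by auto
    moreover have "x \<in> closed_nbhd ?G (3 * (x div 3) + 1)"
      using \<open>x < 3 * k\<close> \<open>x div 3 < k\<close> by (auto simp: closed_nbhd_def open_nbhd_def)
    ultimately show "x \<in> (\<Union>j<k. B \<inter> closed_nbhd ?G (3 * j + 1))"
      using \<open>x \<in> B\<close> by blast
  qed
  moreover have "finite B"
    using B(1) finite_subset by (auto simp: two_limited_packing_def)
  ultimately have "card B \<le> card (\<Union>j<k. B \<inter> closed_nbhd ?G (3 * j + 1))"
    by (intro card_mono) auto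
  also have "\<dots> \<le> (\<Sum>j<k. card (B \<inter> closed_nbhd ?G (3 * j + 1)))"
    by (intro card_UN_le) simp
  also have "\<dots> \<le> (\<Sum>j<k. 2)"
    using B(1) by (intro sum_mono) (auto simp: two_limited_packing_def)
  finally show ?thesis using B(2) by simp
qed

lemma floor_third: "\<lfloor>real n / 3\<rfloor> = int (n div 3)"
  using floor_divide_of_nat_eq[of n 3] by simp

theorem theorem4p5:
  shows "(\<forall>T :: 'a pair_pre_digraph. is_tree T \<longrightarrow>
            int (L2t T) - int (L2 T) \<le> \<lfloor>real (card (pverts T)) / 3\<rfloor>) \<and>
         (\<forall>N. \<exists>T :: nat pair_pre_digraph. is_tree T \<and> N \<le> card (pverts T) \<and>
            int (L2t T) - int (L2 T) = \<lfloor>real (card (pverts T)) / 3\<rfloor>)"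
proof (intro conjI allI impI)
  fix T :: "'a pair_pre_digraph"
  assume "is_tree T"
  from tree_packing_gap[OF this]
  show "int (L2t T) - int (L2 T) \<le> \<lfloor>real (card (pverts T)) / 3\<rfloor>"
    unfolding floor_third by linarith
next
  fix N :: nat
  let ?k = "Suc N"
  let ?T = "path_graph (3 * ?k)"
  have tree: "is_tree ?T" by (rule is_tree_path_graph) simp
  have "int (L2t ?T) - int (L2 ?T) = \<lfloor>real (card (pverts ?T)) / 3\<rfloor>"
    using tree_packing_gap[OF tree] L2t_path_graph_ge[of "3 * ?k"] L2_path_graph_le[of ?k]
    unfolding floor_third by simp
  with tree show "\<exists>T :: nat pair_pre_digraph. is_tree T \<and> N \<le> card (pverts T) \<and>
      int (L2t T) - int (L2 T) = \<lfloor>real (card (pverts T)) / 3\<rfloor>"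
    by (intro exI[of _ ?T]) auto
qed

end
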